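(* Let $(X,\mu,(T_n)_{n\in\mathbb Z})$ be the infinite Chacon system. Let $(x,x')\in X_n\times X_n$ for some $n>0$, and write $x=(f_n,c_{n+1},c_{n+2},\dots)$ and $x'=(f'_n,c'_{n+1},c'_{n+2},\dots)$ in $X_n$. (i) If there is $L>n$ such that $\{c_l,c'_l\}=\{-h_{l-1},h_{l-1}+1\}$ for each $l>L$, then the $(T_1\times T_1)$-orbit of $(x,x')$ intersects each compact subset of $X\times X$ at most finitely many times. (ii) Otherwise $(x,x')$ is $(T_1\times T_1)$-recurrent.
   Context: **The infinite Chacon system.** Put $h_0:=1$, $h_{n+1}:=6h_n+1$ for $n\ge 0$, and for $n\ge 0$ $$F_n:=\left\{-\tfrac{h_n-1}2,-\tfrac{h_n-3}2,\dots,\tfrac{h_n-1}2\right\}\subset\mathbb Z,\qquad C_{n+1}:=\{-h_n,0,h_n+1\}.$$ Let $X_n:=F_n\times C_{n+1}\times C_{n+2}\times\cdots$ with the product topology. The map $(f_n,c_{n+1},c_{n+2},\dots)\mapsto(f_n+c_{n+1},c_{n+2},\dots)$ is a topological embedding $X_n\to X_{n+1}$, by which $X_n$ is regarded as a (compact open) subset of $X_{n+1}$; $X=\bigcup_n X_n$ is the inductive limit, a locally compact non-compact Cantor space. For $g\in\mathbb Z$ and $x\in X$, for all large $n$ one has $x=(f_n,c_{n+1},\dots)\in X_n$ with $g+f_n\in F_n$, and $T_gx:=(g+f_n,c_{n+1},c_{n+2},\dots)\in X_n$; this is a well-defined free continuous $\mathbb Z$-action on $X$. $\mu$ is the unique Borel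 measure on $X$ giving mass $3^{-n}$ to each set $\{(f_n,c_{n+1},\dots)\in X_n: f_n=f\}$, $f\in F_n$, $n\ge0$ (it plays no role in the claim). **Recurrence.** For a homeomorphism $R$ of a space $Z$, a point $z\in Z$ is $R$-recurrent if for each neighborhood $U$ of $z$ there is an integer $n\ne0$ with $R^nz\in U$. *)

theory Defs
  imports "HOL-Analysis.Analysis"
begin

primrec chacon_h :: "nat \<Rightarrow> int" where
  "chacon_h 0 = 1"
| "chacon_h (Suc n) = 6 * chacon_h n + 1"

text \<open>Every \<open>h\<^sub>n\<close> is odd, so the divisions below are exact.\<close>

definition chacon_F :: "nat \<Rightarrow> int set" where
  "chacon_F n = {- ((chacon_h n - 1) div 2) .. (chacon_h n - 1) div 2}"

text \<open>Only used for indices \<open>l \<ge> 1\<close>.\<close>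

definition chacon_C :: "nat \<Rightarrow> int set" where
  "chacon_C l = {- chacon_h (l - 1), 0, chacon_h (l - 1) + 1}"

text \<open>
  A point \<open>(f\<^sub>n, c\<^sub>n\<^sub>+\<^sub>1, c\<^sub>n\<^sub>+\<^sub>2, \<dots>)\<close> of \<open>X\<^sub>n\<close> is a pair \<open>(f, c)\<close> where \<open>c\<close> carries the
  original indices: \<open>c l\<close> is \<open>c\<^sub>l\<close> for \<open>l > n\<close>, and \<open>c l\<close> is \<open>undefined\<close> for \<open>l \<le> n\<close>.
\<close>

definition chacon_level :: "nat \<Rightarrow> (int \<times> (nat \<Rightarrow> int)) set" where
  "chacon_level n = chacon_F n \<times> (\<Pi>\<^sub>E l\<in>{n<..}. chacon_C l)"

definition chacon_level_top :: "nat \<Rightarrow> (int \<times> (nat \<Rightarrow> int)) topology" where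
  "chacon_level_top n =
     prod_topology (discrete_topology (chacon_F n))
       (product_topology (\<lambda>l. discrete_topology (chacon_C l)) {n<..})"

definition chacon_step :: "nat \<Rightarrow> int \<times> (nat \<Rightarrow> int) \<Rightarrow> int \<times> (nat \<Rightarrow> int)" where
  "chacon_step n = (\<lambda>(f, c). (f + c (Suc n), restrict c {Suc n<..}))"

text \<open>The composite embedding \<open>X\<^sub>n \<rightarrow> X\<^sub>n\<^sub>+\<^sub>1 \<rightarrow> \<dots> \<rightarrow> X\<^sub>k\<close>, for \<open>n \<le> k\<close>.\<close>

definition chacon_push :: "nat \<Rightarrow> nat \<Rightarrow> int \<times> (nat \<Rightarrow> int) \<Rightarrow> int \<times> (nat \<Rightarrow> int)" where
  "chacon_push n k = fold chacon_step [n..<k]"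

fun chacon_rel :: "nat \<times> int \<times> (nat \<Rightarrow> int) \<Rightarrow> nat \<times> int \<times> (nat \<Rightarrow> int) \<Rightarrow> bool" where
  "chacon_rel (n, p) (m, q) \<longleftrightarrow>
     p \<in> chacon_level n \<and> q \<in> chacon_level m \<and>
     (\<exists>k. n \<le> k \<and> m \<le> k \<and> chacon_push n k p = chacon_push m k q)"

lemma chacon_h_ge: "chacon_h n \<ge> int n + 1"
  by (induction n) auto

lemma odd_chacon_h: "odd (chacon_h n)"
  by (induction n) auto

lemma chacon_F_iff: "f \<in> chacon_F n \<longleftrightarrow> - chacon_h n < 2 * f \<and> 2 * f < chacon_h n"
proof -
  obtain k where "chacon_h n = 2 * k + 1" using odd_chacon_h oddE by blast
  then show ?thesis by (auto simp: chacon_F_def)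
qed

lemma chacon_level_iff:
  "(f, c) \<in> chacon_level n \<longleftrightarrow> f \<in> chacon_F n \<and> c \<in> (\<Pi>\<^sub>E l\<in>{n<..}. chacon_C l)"
  by (simp add: chacon_level_def)

lemma topspace_chacon_level_top [simp]: "topspace (chacon_level_top n) = chacon_level n"
  by (simp add: chacon_level_top_def chacon_level_def)

lemma chacon_step_bound:
  assumes "f \<in> chacon_F n" "d \<in> chacon_C (Suc n)"
  shows "- (3 * chacon_h n + 1) \<le> 2 * (f + d)" "2 * (f + d) \<le> 3 * chacon_h n + 1"
  using assms chacon_h_ge[of n] by (auto simp: chacon_F_iff chacon_C_def)

lemma chacon_step_in: "p \<in> chacon_level n \<Longrightarrow> chacon_step n p \<in> chacon_level (Suc n)"
proof -
  assume p: "p \<in> chacon_level n"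
  obtain f c where [simp]: "p = (f, c)" by force
  from p have f: "f \<in> chacon_F n" and c: "c \<in> (\<Pi>\<^sub>E l\<in>{n<..}. chacon_C l)"
    by (auto simp: chacon_level_iff)
  then have "c (Suc n) \<in> chacon_C (Suc n)" by auto
  from chacon_step_bound[OF f this] have "f + c (Suc n) \<in> chacon_F (Suc n)"
    using chacon_h_ge[of n] by (simp add: chacon_F_iff)
  moreover have "restrict c {Suc n<..} \<in> (\<Pi>\<^sub>E l\<in>{Suc n<..}. chacon_C l)"
    using c by (simp add: PiE_iff)
  ultimately show ?thesis by (simp add: chacon_step_def chacon_level_iff)
qed

lemma chacon_push_refl [simp]: "chacon_push n n p = p"
  by (simp add: chacon_push_def)

lemma chacon_push_Suc:
  "n \<le> k \<Longrightarrow> chacon_push n (Suc k) p = chacon_step k (chacon_push n k p)"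
  by (simp add: chacon_push_def)

lemma chacon_push_trans:
  assumes "n \<le> k" "k \<le> m"
  shows "chacon_push k m (chacon_push n k p) = chacon_push n m p"
  using assms(2,1) by (induction m rule: dec_induct) (auto simp: chacon_push_Suc)

lemma chacon_push_in:
  assumes "n \<le> k" "p \<in> chacon_level n"
  shows "chacon_push n k p \<in> chacon_level k"
  using assms by (induction k rule: dec_induct) (auto simp: chacon_push_Suc chacon_step_in)

lemma chacon_push_eq:
  assumes "n \<le> k" "(f, c) \<in> chacon_level n"
  shows "chacon_push n k (f, c) = (f + (\<Sum>l\<in>{n<..k}. c l), restrict c {k<..})"
  using assms(1)
proof (induction k rule: dec_induct)
  case base
  have "restrict c {n<..} = c"
    using assms(2) PiE_restrict by (metis chacon_level_iff)
  then show ?case by simp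
next
  case (step k)
  have "{n<..Suc k} = insert (Suc k) {n<..k}" using step.hyps by auto
  then have sum: "(\<Sum>l\<in>{n<..Suc k}. c l) = (\<Sum>l\<in>{n<..k}. c l) + c (Suc k)" by simp
  have res: "restrict (restrict c {k<..}) {Suc k<..} = restrict c {Suc k<..}"
    by (rule ext) (simp add: restrict_def)
  have "chacon_push n (Suc k) (f, c) = chacon_step k (f + (\<Sum>l\<in>{n<..k}. c l), restrict c {k<..})"
    using step.hyps step.IH by (simp only: chacon_push_Suc)
  also have "\<dots> = (f + (\<Sum>l\<in>{n<..Suc k}. c l), restrict c {Suc k<..})"
    unfolding chacon_step_def sum prod.case res by (simp add: add.assoc)
  finally show ?case .
qed

lemma chacon_level_0_ex: "(0, \<lambda>l. if l > 0 then 0 else undefined) \<in> chacon_level 0"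
  by (auto simp: chacon_level_def chacon_F_iff chacon_C_def PiE_iff extensional_def)

lemma part_equivp_chacon_rel: "part_equivp chacon_rel"
proof (rule part_equivpI)
  show "\<exists>a. chacon_rel a a"
    by (rule exI[of _ "(0, 0, \<lambda>l. if l > 0 then 0 else undefined)"])
      (auto simp: chacon_level_0_ex)
  show "symp chacon_rel"
  proof (rule sympI)
    fix a b assume "chacon_rel a b"
    moreover obtain n p m q where "a = (n, p)" "b = (m, q)" by (metis surj_pair)
    ultimately show "chacon_rel b a" by force
  qed
  show "transp chacon_rel"
  proof (rule transpI)
    fix a b d assume ab: "chacon_rel a b" and bd: "chacon_rel b d"
    obtain n p m q l r where eq: "a = (n, p)" "b = (m, q)" "d = (l, r)"
      by (metis surj_pair)
    from ab eq obtain k where k: "n \<le> k" "m \<le> k" "chacon_push n k p = chacon_push m k q"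
      by auto
    from bd eq obtain j where j: "m \<le> j" "l \<le> j" "chacon_push m j q = chacon_push l j r"
      by auto
    let ?i = "max k j"
    have "chacon_push n ?i p = chacon_push k ?i (chacon_push n k p)"
      using k(1) by (simp add: chacon_push_trans)
    also have "\<dots> = chacon_push j ?i (chacon_push m j q)"
      using k(2) j(1) by (simp add: k(3) chacon_push_trans)
    also have "\<dots> = chacon_push l ?i r"
      using j(2) by (simp add: j(3) chacon_push_trans)
    finally have "\<exists>i. n \<le> i \<and> l \<le> i \<and> chacon_push n i p = chacon_push l i r"
      using k(1) j(2) by (intro exI[of _ ?i]) (simp add: max.coboundedI1 max.coboundedI2)
    then show "chacon_rel a d" using ab bd eq by simp
  qed
qed

text \<open>
  The inductive limit \<open>X\<close>: its points are classes of pairs \<open>(n, p)\<close> with \<open>p \<in> X\<^sub>n\<close>, and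
  \<open>chacon_pt n\<close> is the canonical map \<open>X\<^sub>n \<rightarrow> X\<close> by which \<open>X\<^sub>n\<close> is regarded as a subset of \<open>X\<close>.
\<close>

quotient_type chacon = "nat \<times> int \<times> (nat \<Rightarrow> int)" / partial: chacon_rel
  by (rule part_equivp_chacon_rel)

definition chacon_pt :: "nat \<Rightarrow> int \<times> (nat \<Rightarrow> int) \<Rightarrow> chacon" where
  "chacon_pt n p = abs_chacon (n, p)"

instantiation chacon :: topological_space
begin

definition open_chacon :: "chacon set \<Rightarrow> bool" where
  "open_chacon U \<longleftrightarrow>
     (\<forall>n. openin (chacon_level_top n) {p \<in> chacon_level n. chacon_pt n p \<in> U})"

instance
proof
  have "openin (chacon_level_top n) (chacon_level n)" for n
    by (metis openin_topspace topspace_chacon_level_top)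
  then show "open (UNIV :: chacon set)"
    by (simp add: open_chacon_def)
next
  fix S T :: "chacon set" assume "open S" "open T"
  then have "openin (chacon_level_top n) ({p \<in> chacon_level n. chacon_pt n p \<in> S} \<inter>
               {p \<in> chacon_level n. chacon_pt n p \<in> T})" for n
    by (auto simp: open_chacon_def)
  moreover have "{p \<in> chacon_level n. chacon_pt n p \<in> S} \<inter> {p \<in> chacon_level n. chacon_pt n p \<in> T}
                 = {p \<in> chacon_level n. chacon_pt n p \<in> S \<inter> T}" for n
    by auto
  ultimately show "open (S \<inter> T)" by (simp add: open_chacon_def)
next
  fix K :: "chacon set set" assume K: "\<forall>S\<in>K. open S"
  have "{p \<in> chacon_level n. chacon_pt n p \<in> \<Union>K}
        = (\<Union>S\<in>K. {p \<in> chacon_level n. chacon_pt n p \<in> S})" for n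
    by auto
  moreover have "openin (chacon_level_top n) (\<Union>S\<in>K. {p \<in> chacon_level n. chacon_pt n p \<in> S})" for n
    using K by (intro openin_Union) (auto simp: open_chacon_def)
  ultimately show "open (\<Union>K)" by (simp add: open_chacon_def)
qed

end

definition chacon_T :: "int \<Rightarrow> chacon \<Rightarrow> chacon" where
  "chacon_T g x = (THE y. \<exists>n f c. (f, c) \<in> chacon_level n \<and> g + f \<in> chacon_F n \<and>
                     x = chacon_pt n (f, c) \<and> y = chacon_pt n (g + f, c))"

lemma chacon_pt_eq_iff:
  assumes "p \<in> chacon_level n" "q \<in> chacon_level m"
  shows "chacon_pt n p = chacon_pt m q \<longleftrightarrow>
           (\<exists>k. n \<le> k \<and> m \<le> k \<and> chacon_push n k p = chacon_push m k q)"
proof -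
  have "chacon_rel (n, p) (n, p)" "chacon_rel (m, q) (m, q)" using assms by auto
  then have "chacon_pt n p = chacon_pt m q \<longleftrightarrow> chacon_rel (n, p) (m, q)"
    using Quotient3_rel[OF Quotient3_chacon, of "(n, p)" "(m, q)"]
    by (simp only: chacon_pt_def simp_thms)
  then show ?thesis using assms by simp
qed

lemma chacon_pt_push:
  assumes "p \<in> chacon_level n" "n \<le> k"
  shows "chacon_pt k (chacon_push n k p) = chacon_pt n p"
proof -
  have "chacon_push k k (chacon_push n k p) = chacon_push n k p" by simp
  then show ?thesis
    using assms chacon_pt_eq_iff[OF chacon_push_in[OF assms(2,1)] assms(1)] by blast
qed

lemma chacon_pt_step:
  "p \<in> chacon_level n \<Longrightarrow> chacon_pt (Suc n) (chacon_step n p) = chacon_pt n p"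
  using chacon_pt_push[of p n "Suc n"] by (simp add: chacon_push_Suc)

lemma chacon_push_inj:
  assumes "p \<in> chacon_level n" "q \<in> chacon_level n" "n \<le> k"
    and "chacon_push n k p = chacon_push n k q"
  shows "p = q"
  using assms(3,4)
proof (induction k rule: dec_induct)
  case (step k)
  obtain f c where p: "chacon_push n k p = (f, c)" by force
  obtain g d where q: "chacon_push n k q = (g, d)" by force
  have fc: "(f, c) \<in> chacon_level k" and gd: "(g, d) \<in> chacon_level k"
    using chacon_push_in[OF step.hyps(1)] assms(1,2) p q by metis+
  have eq: "f + c (Suc k) = g + d (Suc k)" "restrict c {Suc k<..} = restrict d {Suc k<..}"
    using step.prems step.hyps(1) by (auto simp: chacon_push_Suc p q chacon_step_def)
  have "c (Suc k) \<in> chacon_C (Suc k)" "d (Suc k) \<in> chacon_C (Suc k)"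
    using fc gd by (auto simp: chacon_level_iff)
  then have cd: "c (Suc k) = d (Suc k) \<and> f = g"
    using eq(1) fc gd chacon_h_ge[of k] unfolding chacon_level_iff chacon_F_iff chacon_C_def
    by simp linarith
  have "c = d"
  proof
    fix l
    consider "l > Suc k" | "l = Suc k" | "l \<le> k" by linarith
    then show "c l = d l"
    proof cases
      case 1
      then show ?thesis using fun_cong[OF eq(2), of l] by simp
    next
      case 3
      then show ?thesis using fc gd by (auto simp: chacon_level_iff PiE_iff extensional_def)
    qed (use cd in auto)
  qed
  then show ?case using cd p q step.IH by simp
qed auto

lemma inj_on_chacon_pt: "inj_on (chacon_pt n) (chacon_level n)"
  by (rule inj_onI) (metis chacon_pt_eq_iff chacon_push_inj)

lemma chacon_pt_cases:
  obtains n f c where "(f, c) \<in> chacon_level n" "x = chacon_pt n (f, c)"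
proof -
  obtain a where a: "chacon_rel a a" "x = abs_chacon a"
    using Quotient3_abs_rep[OF Quotient3_chacon] Quotient3_rep_reflp[OF Quotient3_chacon] by metis
  then show ?thesis using that by (cases a) (auto simp: chacon_pt_def)
qed

lemma chacon_shift_push:
  assumes "(f, c) \<in> chacon_level n" "g + f \<in> chacon_F n" "n \<le> k"
  shows "chacon_push n k (g + f, c) = (g + fst (chacon_push n k (f, c)), snd (chacon_push n k (f, c)))"
proof -
  have "(g + f, c) \<in> chacon_level n" using assms by (simp add: chacon_level_iff)
  then show ?thesis using assms by (simp add: chacon_push_eq)
qed

lemma chacon_T_pt:
  assumes "(f, c) \<in> chacon_level n" "g + f \<in> chacon_F n"
  shows "chacon_T g (chacon_pt n (f, c)) = chacon_pt n (g + f, c)"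
  unfolding chacon_T_def
proof (rule the_equality)
  show "\<exists>n' f' c'. (f', c') \<in> chacon_level n' \<and> g + f' \<in> chacon_F n' \<and>
          chacon_pt n (f, c) = chacon_pt n' (f', c') \<and>
          chacon_pt n (g + f, c) = chacon_pt n' (g + f', c')"
    using assms by blast
next
  fix y
  assume "\<exists>n' f' c'. (f', c') \<in> chacon_level n' \<and> g + f' \<in> chacon_F n' \<and>
            chacon_pt n (f, c) = chacon_pt n' (f', c') \<and> y = chacon_pt n' (g + f', c')"
  then obtain m f' c' where m: "(f', c') \<in> chacon_level m" "g + f' \<in> chacon_F m"
    "chacon_pt n (f, c) = chacon_pt m (f', c')" and y: "y = chacon_pt m (g + f', c')"
    by blast
  then obtain k where k: "n \<le> k" "m \<le> k" "chacon_push n k (f, c) = chacon_push m k (f', c')"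
    using chacon_pt_eq_iff[OF assms(1) m(1)] by auto
  have "chacon_push n k (g + f, c) = chacon_push m k (g + f', c')"
    using chacon_shift_push[OF assms k(1)] chacon_shift_push[OF m(1,2) k(2)] k(3) by simp
  moreover have "(g + f, c) \<in> chacon_level n" "(g + f', c') \<in> chacon_level m"
    using assms m by (auto simp: chacon_level_iff)
  ultimately show "y = chacon_pt n (g + f, c)"
    using y k chacon_pt_eq_iff by metis
qed

lemma chacon_push_margin:
  assumes "p \<in> chacon_level n" "n < k" "\<bar>g\<bar> < int k"
  shows "g + fst (chacon_push n k p) \<in> chacon_F k"
proof -
  obtain j where j: "k = Suc j" "n \<le> j" using assms(2) by (cases k) auto
  obtain f c where p: "chacon_push n j p = (f, c)" by force
  with chacon_push_in[OF j(2) assms(1)] have fc: "(f, c) \<in> chacon_level j" by simp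
  then have *: "f \<in> chacon_F j" "c (Suc j) \<in> chacon_C (Suc j)"
    by (auto simp: chacon_level_iff)
  have "- int j \<le> g" "g \<le> int j" using assms(3) j(1) by auto
  then show ?thesis using chacon_step_bound[OF *] j p chacon_h_ge[of j]
    by (simp add: chacon_push_Suc chacon_step_def chacon_F_iff)
qed

lemma chacon_T_0: "chacon_T 0 x = x"
  by (rule chacon_pt_cases[of x]) (simp add: chacon_T_pt chacon_level_iff)

lemma chacon_T_add: "chacon_T (a + b) x = chacon_T a (chacon_T b x)"
proof (rule chacon_pt_cases[of x])
  fix n f c assume fc: "(f, c) \<in> chacon_level n" and x: "x = chacon_pt n (f, c)"
  define k where "k = Suc (n + nat \<bar>a\<bar> + nat \<bar>b\<bar>)"
  obtain f' c' where p: "chacon_push n k (f, c) = (f', c')" by force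
  have k: "n \<le> k" "n < k" by (auto simp: k_def)
  have x': "x = chacon_pt k (f', c')" using chacon_pt_push[OF fc k(1)] p x by simp
  have in_level: "(f', c') \<in> chacon_level k" using chacon_push_in[OF k(1) fc] p by simp
  have b: "b + f' \<in> chacon_F k" and ab: "a + b + f' \<in> chacon_F k"
    using chacon_push_margin[OF fc k(2), of b] chacon_push_margin[OF fc k(2), of "a + b"] p
    by (auto simp: k_def)
  have "(b + f', c') \<in> chacon_level k" using in_level b by (simp add: chacon_level_iff)
  then show ?thesis
    using in_level b ab x' chacon_T_pt[of f' c' k] chacon_T_pt[of "b + f'" c' k a]
    by (simp add: add.assoc)
qed

lemma continuous_map_into_discrete:
  assumes "continuous_map X (discrete_topology UNIV) f" "\<And>p. p \<in> topspace X \<Longrightarrow> f p \<in> A"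
  shows "continuous_map X (discrete_topology A) f"
proof -
  have "continuous_map X (subtopology (discrete_topology UNIV) A) f"
    by (rule continuous_map_into_subtopology[OF assms(1)]) (use assms(2) in blast)
  then show ?thesis by (simp add: subtopology_discrete_topology)
qed

lemma continuous_map_chacon_step:
  "continuous_map (chacon_level_top n) (chacon_level_top (Suc n)) (chacon_step n)"
proof -
  let ?P = "product_topology (\<lambda>l. discrete_topology (chacon_C l))"
  have snd: "continuous_map (chacon_level_top n) (?P {n<..}) snd"
    unfolding chacon_level_top_def by (rule continuous_map_snd)
  have fst: "continuous_map (chacon_level_top n) (discrete_topology (chacon_F n)) fst"
    unfolding chacon_level_top_def by (rule continuous_map_fst)
  have proj: "continuous_map (chacon_level_top n) (discrete_topology (chacon_C l)) (\<lambda>p. snd p l)"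
    if "l \<in> {n<..}" for l
    using continuous_map_compose[OF snd continuous_map_product_projection[OF that]]
    by (simp add: comp_def)
  have "continuous_map (chacon_level_top n)
          (prod_topology (discrete_topology (chacon_F n)) (discrete_topology (chacon_C (Suc n))))
          (\<lambda>p. (fst p, snd p (Suc n)))"
    using fst proj[of "Suc n"] by (simp add: continuous_map_pairedI)
  then have "continuous_map (chacon_level_top n)
          (discrete_topology (chacon_F n \<times> chacon_C (Suc n))) (\<lambda>p. (fst p, snd p (Suc n)))"
    by (simp add: prod_topology_discrete_topology)
  then have "continuous_map (chacon_level_top n) (discrete_topology UNIV)
          ((\<lambda>(a, b). a + b) \<circ> (\<lambda>p. (fst p, snd p (Suc n))))"
    by (rule continuous_map_compose) simp
  then have *: "continuous_map (chacon_level_top n) (discrete_topology UNIV) (\<lambda>p. fst (chacon_step n p))"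
    by (simp add: comp_def chacon_step_def case_prod_unfold)
  have "chacon_step n p \<in> chacon_level (Suc n)" if "p \<in> topspace (chacon_level_top n)" for p
    using that chacon_step_in by simp
  then have "fst (chacon_step n p) \<in> chacon_F (Suc n)" if "p \<in> topspace (chacon_level_top n)" for p
    using that unfolding chacon_level_def by (metis mem_Times_iff)
  then have 1: "continuous_map (chacon_level_top n) (discrete_topology (chacon_F (Suc n)))
                  (\<lambda>p. fst (chacon_step n p))"
    by (rule continuous_map_into_discrete[OF *])
  have "continuous_map (chacon_level_top n) (?P {Suc n<..}) (\<lambda>p. restrict (snd p) {Suc n<..})"
    unfolding continuous_map_componentwise
  proof (intro conjI ballI)
    fix l assume "l \<in> {Suc n<..}"
    then show "continuous_map (chacon_level_top n) (discrete_topology (chacon_C l))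
                 (\<lambda>p. restrict (snd p) {Suc n<..} l)"
      using proj[of l] by simp
  qed auto
  then have 2: "continuous_map (chacon_level_top n) (?P {Suc n<..}) (\<lambda>p. snd (chacon_step n p))"
    by (simp add: chacon_step_def case_prod_unfold)
  show ?thesis
    using continuous_map_pairedI[OF 1 2] by (simp add: chacon_level_top_def)
qed

lemma continuous_map_chacon_push:
  assumes "n \<le> k"
  shows "continuous_map (chacon_level_top n) (chacon_level_top k) (chacon_push n k)"
  using assms
proof (induction k rule: dec_induct)
  case base
  have "chacon_push n n = (\<lambda>p. p)" by (rule ext) simp
  then show ?case by simp
next
  case (step k)
  have "chacon_push n (Suc k) = chacon_step k \<circ> chacon_push n k"
    using step.hyps by (simp add: fun_eq_iff chacon_push_Suc)
  then show ?case
    using continuous_map_compose[OF step.IH continuous_map_chacon_step] by (simp only:)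
qed

lemma continuous_chacon_T: "continuous_on UNIV (chacon_T g)"
proof -
  have "open (chacon_T g -` V)" if V: "open V" for V
    unfolding open_chacon_def
  proof
    fix n
    define k where "k = Suc (n + nat \<bar>g\<bar>)"
    have k: "n \<le> k" "n < k" "\<bar>g\<bar> < int k" by (auto simp: k_def)
    define q where "q p = (g + fst (chacon_push n k p), snd (chacon_push n k p))" for p
    have q: "chacon_T g (chacon_pt n p) = chacon_pt k (q p)" "q p \<in> chacon_level k"
      if "p \<in> chacon_level n" for p
    proof -
      obtain f c where fc: "chacon_push n k p = (f, c)" by force
      have "(f, c) \<in> chacon_level k" using chacon_push_in[OF k(1) that] fc by simp
      moreover have "g + f \<in> chacon_F k" using chacon_push_margin[OF that k(2,3)] fc by simp
      ultimately show "chacon_T g (chacon_pt n p) = chacon_pt k (q p)" "q p \<in> chacon_level k"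
        using chacon_T_pt[of f c k g] chacon_pt_push[OF that k(1)] fc
        by (simp_all add: q_def chacon_level_iff)
    qed
    have push: "continuous_map (chacon_level_top n) (chacon_level_top k) (chacon_push n k)"
      by (rule continuous_map_chacon_push[OF k(1)])
    have fst: "continuous_map (chacon_level_top n) (discrete_topology (chacon_F k)) (fst \<circ> chacon_push n k)"
      using push unfolding chacon_level_top_def
      by (rule continuous_map_compose[OF _ continuous_map_fst])
    have snd: "continuous_map (chacon_level_top n)
        (product_topology (\<lambda>l. discrete_topology (chacon_C l)) {k<..}) (snd \<circ> chacon_push n k)"
      using push unfolding chacon_level_top_def
      by (rule continuous_map_compose[OF _ continuous_map_snd])
    have "continuous_map (chacon_level_top n) (discrete_topology UNIV)
            ((+) g \<circ> (fst \<circ> chacon_push n k))"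
      by (rule continuous_map_compose[OF fst]) simp
    moreover have "g + fst (chacon_push n k p) \<in> chacon_F k"
      if "p \<in> topspace (chacon_level_top n)" for p
      using chacon_push_margin[OF _ k(2,3)] that by simp
    ultimately have 1: "continuous_map (chacon_level_top n) (discrete_topology (chacon_F k))
                    (\<lambda>p. g + fst (chacon_push n k p))"
      unfolding comp_def by (rule continuous_map_into_discrete)
    have "continuous_map (chacon_level_top n) (chacon_level_top k) q"
      using continuous_map_pairedI[OF 1 snd[unfolded comp_def]]
      unfolding q_def[abs_def] chacon_level_top_def[of k] by simp
    moreover have "openin (chacon_level_top k) {r \<in> chacon_level k. chacon_pt k r \<in> V}"
      using V by (simp add: open_chacon_def)
    ultimately have "openin (chacon_level_top n)
        {p \<in> topspace (chacon_level_top n). q p \<in> {r \<in> chacon_level k. chacon_pt k r \<in> V}}"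
      by (rule openin_continuous_map_preimage)
    moreover have "{p \<in> topspace (chacon_level_top n). q p \<in> {r \<in> chacon_level k. chacon_pt k r \<in> V}}
        = {p \<in> chacon_level n. chacon_pt n p \<in> chacon_T g -` V}"
      using q by auto
    ultimately show "openin (chacon_level_top n) {p \<in> chacon_level n. chacon_pt n p \<in> chacon_T g -` V}"
      by simp
  qed
  then show ?thesis by (simp add: continuous_on_open_vimage)
qed

lemma homeomorphism_chacon_T: "homeomorphism UNIV UNIV (chacon_T g) (chacon_T (- g))"
proof -
  have "chacon_T (- g) (chacon_T g x) = x" "chacon_T g (chacon_T (- g) x) = x" for x
    using chacon_T_add[of "- g" g x] chacon_T_add[of g "- g" x] by (simp_all add: chacon_T_0)
  then show ?thesis
    using continuous_chacon_T by (intro homeomorphismI) simp_all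
qed

text \<open>The integer iterates \<open>R\<^sup>k\<close> of a bijection \<open>R\<close>.\<close>

definition int_iter :: "('a \<Rightarrow> 'a) \<Rightarrow> int \<Rightarrow> 'a \<Rightarrow> 'a" where
  "int_iter R k = (if k \<ge> 0 then R ^^ nat k else inv R ^^ nat (- k))"

definition recurrent_point :: "('a::topological_space \<Rightarrow> 'a) \<Rightarrow> 'a \<Rightarrow> bool" where
  "recurrent_point R z \<longleftrightarrow> (\<forall>U. open U \<and> z \<in> U \<longrightarrow> (\<exists>k::int. k \<noteq> 0 \<and> int_iter R k z \<in> U))"

end

theory Submission
  imports Defs
begin

text \<open>
  Changing finitely many digits of \<open>x\<close> and of \<open>x'\<close> moves both points by the same \<open>T\<^sub>k\<close> iff the
  change preserves the sum of the digit differences \<open>c'\<^sub>l - c\<^sub>l\<close>. So \<open>(x, x')\<close> is recurrent as soon as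
  such a change exists beyond every level.

  If \<open>c\<^sub>l = c'\<^sub>l\<close> infinitely often, both digits are changed alike at one level. Otherwise, unless the
  digits are eventually opposite, one may assume by symmetry that \<open>c'\<^sub>l = 0\<close> and \<open>c\<^sub>l \<noteq> 0\<close> infinitely
  often. At such a level, \<open>(c\<^sub>l, 0) \<mapsto> (0, 1 - c\<^sub>l)\<close> raises the difference by \<open>1\<close>, while
  \<open>(-h, 0) \<mapsto> (0, 0)\<close> or \<open>(h + 1, 0) \<mapsto> (h + 1, -h)\<close>, where \<open>h = h\<^sub>l\<^sub>-\<^sub>1\<close>, lowers it by \<open>h\<close>; one
  change of the second kind is compensated by \<open>h\<close> changes of the first kind at higher levels.

  If the digits are opposite at all levels above \<open>m\<close>, the difference \<open>\<plusminus>(2h + 1)\<close> is extremal and at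
  least \<open>h\<close> away from every other one. For points of \<open>X\<^sub>m\<close> and \<open>j > m\<close>, the two positions in \<open>F\<^sub>j\<close>
  differ by less than \<open>h\<^sub>j / 2\<close>, so a return to \<open>X\<^sub>m \<times> X\<^sub>m\<close> leaves all digits above level \<open>m + 1\<close>
  unchanged, which bounds the return time.
\<close>

section \<open>Iterates of the product map, and recurrence tested on boxes\<close>

lemma int_iter_map_prod_chacon_T:
  "int_iter (map_prod (chacon_T 1) (chacon_T 1)) k (x, y) = (chacon_T k x, chacon_T k y)"
proof -
  have pow: "(map_prod (chacon_T a) (chacon_T a) ^^ j) (x, y) =
      (chacon_T (a * int j) x, chacon_T (a * int j) y)" for a j
    by (induction j) (simp_all add: chacon_T_0 algebra_simps flip: chacon_T_add)
  have "inv (map_prod (chacon_T 1) (chacon_T 1)) = map_prod (chacon_T (-1)) (chacon_T (-1))"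
    by (rule inv_equality) (auto simp: chacon_T_0 simp flip: chacon_T_add)
  then show ?thesis
    using pow[of "nat k" 1] pow[of "nat (-k)" "-1"] by (simp add: int_iter_def)
qed

text \<open>Boxes form a base of the product topology. This form is visibly symmetric in
  \<open>x\<close> and \<open>x'\<close>, so the two points may be exchanged later.\<close>

lemma recurrent_point_map_prod_iff:
  "recurrent_point (map_prod (chacon_T 1) (chacon_T 1)) (x, x') \<longleftrightarrow>
     (\<forall>V V'. open V \<and> open V' \<and> x \<in> V \<and> x' \<in> V' \<longrightarrow>
        (\<exists>k. k \<noteq> 0 \<and> chacon_T k x \<in> V \<and> chacon_T k x' \<in> V'))"
  (is "?L \<longleftrightarrow> ?R")
proof
  assume L: ?L
  show ?R
  proof (intro allI impI)
    fix V V' assume "open V \<and> open V' \<and> x \<in> V \<and> x' \<in> V'"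
    then have "open (V \<times> V')" "(x, x') \<in> V \<times> V'" by (auto simp: open_Times)
    then show "\<exists>k. k \<noteq> 0 \<and> chacon_T k x \<in> V \<and> chacon_T k x' \<in> V'"
      using L by (auto simp: recurrent_point_def int_iter_map_prod_chacon_T)
  qed
next
  assume R: ?R
  show ?L
    unfolding recurrent_point_def int_iter_map_prod_chacon_T
  proof (intro allI impI)
    fix U assume "open U \<and> (x, x') \<in> U"
    then obtain V V' where "open V" "open V'" "(x, x') \<in> V \<times> V'" "V \<times> V' \<subseteq> U"
      by (metis open_prod_elim)
    moreover from this obtain k where "k \<noteq> 0" "chacon_T k x \<in> V" "chacon_T k x' \<in> V'"
      using R by (metis mem_Sigma_iff)
    ultimately show "\<exists>k. k \<noteq> 0 \<and> (chacon_T k x, chacon_T k x') \<in> U"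
      by (metis mem_Sigma_iff subsetD)
  qed
qed

section \<open>Recurrence from finite changes of digits\<close>

text \<open>Pushed to level \<open>M\<close>, both points have the same tail, and their coordinates
  in F_M differ exactly by the sum; there \<open>chacon_T_pt\<close> applies.\<close>

lemma chacon_T_change_digits:
  assumes "(f, c) \<in> chacon_level n" "(f, d) \<in> chacon_level n" "n \<le> M" "\<And>l. l > M \<Longrightarrow> d l = c l"
  shows "chacon_T (\<Sum>l\<in>{n<..M}. d l - c l) (chacon_pt n (f, c)) = chacon_pt n (f, d)"
proof -
  let ?g = "\<Sum>l\<in>{n<..M}. d l - c l"
  obtain a e where ae: "chacon_push n M (f, c) = (a, e)" by force
  have a: "a = f + (\<Sum>l\<in>{n<..M}. c l)" and e: "e = restrict c {M<..}"
    using chacon_push_eq[OF assms(3,1)] ae by auto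
  have "restrict d {M<..} = e"
    unfolding e by (rule restrict_ext) (use assms(4) in auto)
  then have pd: "chacon_push n M (f, d) = (?g + a, e)"
    using chacon_push_eq[OF assms(3,2)] by (simp add: a sum_subtractf)
  have "(a, e) \<in> chacon_level M" "(?g + a, e) \<in> chacon_level M"
    using chacon_push_in[OF assms(3)] assms(1,2) ae pd by metis+
  then have "chacon_T ?g (chacon_pt M (a, e)) = chacon_pt M (?g + a, e)"
    by (intro chacon_T_pt) (auto simp: chacon_level_iff)
  then show ?thesis
    using chacon_pt_push[OF assms(1,3)] chacon_pt_push[OF assms(2,3)] by (simp only: ae pd)
qed

text \<open>A basic open set of the product topology restricts only finitely many digits;
  \<open>N\<close> bounds their indices.\<close>

lemma open_chacon_contains_cylinder:
  assumes "open U" "(f, c) \<in> chacon_level n" "chacon_pt n (f, c) \<in> U"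
  obtains N where "n \<le> N"
    "\<And>d. (f, d) \<in> chacon_level n \<Longrightarrow> (\<And>l. l \<le> N \<Longrightarrow> d l = c l) \<Longrightarrow> chacon_pt n (f, d) \<in> U"
proof -
  let ?P = "product_topology (\<lambda>l. discrete_topology (chacon_C l)) {n<..}"
  have "openin (chacon_level_top n) {p \<in> chacon_level n. chacon_pt n p \<in> U}"
    using assms(1) by (simp add: open_chacon_def)
  moreover have "(f, c) \<in> {p \<in> chacon_level n. chacon_pt n p \<in> U}" using assms by simp
  ultimately obtain A B where AB: "openin ?P B" "f \<in> A" "c \<in> B"
    "A \<times> B \<subseteq> {p \<in> chacon_level n. chacon_pt n p \<in> U}"
    unfolding chacon_level_top_def openin_prod_topology_alt by meson
  obtain W where W: "c \<in> Pi\<^sub>E {n<..} W"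
    "finite {l. W l \<noteq> topspace (discrete_topology (chacon_C l))}" "Pi\<^sub>E {n<..} W \<subseteq> B"
    using product_topology_open_contains_basis[OF AB(1,3)] by blast
  define J where "J = {l. W l \<noteq> chacon_C l}"
  have J: "finite J" using W(2) by (simp add: J_def)
  show ?thesis
  proof (rule that[of "Max (insert n J)"])
    show "n \<le> Max (insert n J)" using J by simp
    fix d assume d: "(f, d) \<in> chacon_level n" "\<And>l. l \<le> Max (insert n J) \<Longrightarrow> d l = c l"
    have "d l \<in> W l" if "l > n" for l
    proof (cases "l \<in> J")
      case True
      then have "d l = c l" using d(2) J by simp
      then show ?thesis using W(1) that by auto
    next
      case False
      then show ?thesis using d(1) that by (auto simp: J_def chacon_level_iff)
    qed
    then have "d \<in> Pi\<^sub>E {n<..} W" using d(1) by (auto simp: chacon_level_iff PiE_iff)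
    then show "chacon_pt n (f, d) \<in> U" using AB W by blast
  qed
qed

text \<open>This turns recurrence into combinatorics: agreement up to \<open>N\<close> keeps the
  points in given neighborhoods, agreement beyond \<open>M\<close> puts each new point on the orbit
  of the old one, and equal sums make the time the same in both factors.\<close>

lemma recurrent_point_if_change_digits:
  assumes "(f, c) \<in> chacon_level n" "(f', c') \<in> chacon_level n"
    and "\<And>N. n \<le> N \<Longrightarrow> \<exists>M\<ge>n. \<exists>d d'. (f, d) \<in> chacon_level n \<and> (f', d') \<in> chacon_level n \<and> d \<noteq> c \<and>
      (\<forall>l. l \<le> N \<or> M < l \<longrightarrow> d l = c l \<and> d' l = c' l) \<and>
      (\<Sum>l\<in>{n<..M}. d l - c l) = (\<Sum>l\<in>{n<..M}. d' l - c' l)"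
  shows "recurrent_point (map_prod (chacon_T 1) (chacon_T 1)) (chacon_pt n (f, c), chacon_pt n (f', c'))"
  unfolding recurrent_point_map_prod_iff
proof (intro allI impI)
  fix V V' assume V: "open V \<and> open V' \<and> chacon_pt n (f, c) \<in> V \<and> chacon_pt n (f', c') \<in> V'"
  obtain N where N: "n \<le> N"
    "\<And>d. (f, d) \<in> chacon_level n \<Longrightarrow> (\<And>l. l \<le> N \<Longrightarrow> d l = c l) \<Longrightarrow> chacon_pt n (f, d) \<in> V"
    using open_chacon_contains_cylinder assms(1) V by metis
  obtain N' where N': "n \<le> N'"
    "\<And>d. (f', d) \<in> chacon_level n \<Longrightarrow> (\<And>l. l \<le> N' \<Longrightarrow> d l = c' l) \<Longrightarrow> chacon_pt n (f', d) \<in> V'"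
    using open_chacon_contains_cylinder assms(2) V by metis
  have "n \<le> max N N'" using N(1) by simp
  from assms(3)[OF this] obtain M d d' where M: "n \<le> M"
    and d: "(f, d) \<in> chacon_level n" "(f', d') \<in> chacon_level n" "d \<noteq> c"
    and eq: "\<And>l. l \<le> max N N' \<or> M < l \<Longrightarrow> d l = c l \<and> d' l = c' l"
    and sum: "(\<Sum>l\<in>{n<..M}. d l - c l) = (\<Sum>l\<in>{n<..M}. d' l - c' l)"
    by blast
  let ?k = "\<Sum>l\<in>{n<..M}. d l - c l"
  have T: "chacon_T ?k (chacon_pt n (f, c)) = chacon_pt n (f, d)"
    by (rule chacon_T_change_digits[OF assms(1) d(1) M]) (use eq in blast)
  have T': "chacon_T ?k (chacon_pt n (f', c')) = chacon_pt n (f', d')"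
    unfolding sum by (rule chacon_T_change_digits[OF assms(2) d(2) M]) (use eq in blast)
  have eqN: "l \<le> N \<Longrightarrow> d l = c l" "l \<le> N' \<Longrightarrow> d' l = c' l" for l
    using eq[of l] by (simp_all add: le_max_iff_disj)
  \<comment> \<open>The time is nonzero because it moves the first point; nothing is needed about
    the second.\<close>
  have "chacon_pt n (f, d) \<noteq> chacon_pt n (f, c)"
    using inj_onD[OF inj_on_chacon_pt _ d(1) assms(1)] d(3) by auto
  then have "?k \<noteq> 0" using T by (metis chacon_T_0)
  moreover have "chacon_pt n (f, d) \<in> V" using N(2)[OF d(1)] eqN(1) by blast
  moreover have "chacon_pt n (f', d') \<in> V'" using N'(2)[OF d(2)] eqN(2) by blast
  ultimately show "\<exists>k. k \<noteq> 0 \<and> chacon_T k (chacon_pt n (f, c)) \<in> V \<and> chacon_T k (chacon_pt n (f', c')) \<in> V'"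
    using T T' by metis
qed

lemma chacon_level_change_digits:
  assumes "(f, c) \<in> chacon_level n" "\<And>l. l > n \<Longrightarrow> d l \<in> chacon_C l" "\<And>l. l \<le> n \<Longrightarrow> d l = c l"
  shows "(f, d) \<in> chacon_level n"
  using assms by (auto simp: chacon_level_iff PiE_iff extensional_def)

lemma chacon_level_digit:
  "(f, c) \<in> chacon_level n \<Longrightarrow> l > n \<Longrightarrow> c l \<in> {- chacon_h (l - 1), 0, chacon_h (l - 1) + 1}"
  by (auto simp: chacon_level_iff PiE_iff chacon_C_def)

lemma recurrent_point_if_equal_digits:
  assumes c: "(f, c) \<in> chacon_level n" and c': "(f', c') \<in> chacon_level n"
    and inf: "infinite {l. c l = c' l}"
  shows "recurrent_point (map_prod (chacon_T 1) (chacon_T 1)) (chacon_pt n (f, c), chacon_pt n (f', c'))"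
proof (rule recurrent_point_if_change_digits[OF c c'])
  fix N assume N: "n \<le> N"
  obtain l where l: "l > N" "c l = c' l"
    using inf unfolding infinite_nat_iff_unbounded by blast
  have "\<exists>b \<in> chacon_C l. b \<noteq> c l"
    using chacon_h_ge[of "l - 1"] by (cases "c l = 0") (auto simp: chacon_C_def)
  then obtain b where b: "b \<in> chacon_C l" "b \<noteq> c l" by blast
  have dig: "c j \<in> chacon_C j" "c' j \<in> chacon_C j" if "j > n" for j
    using c c' that by (auto simp: chacon_level_iff)
  have "(f, c(l := b)) \<in> chacon_level n"
    by (rule chacon_level_change_digits[OF c]) (use dig b l N in auto)
  moreover have "(f', c'(l := b)) \<in> chacon_level n"
    by (rule chacon_level_change_digits[OF c']) (use dig b l N in auto)
  moreover have "c(l := b) \<noteq> c" using b(2) by (metis fun_upd_same)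
  moreover have "\<forall>j. j \<le> N \<or> l < j \<longrightarrow> (c(l := b)) j = c j \<and> (c'(l := b)) j = c' j"
    using l(1) by auto
  moreover have "(\<Sum>j\<in>{n<..l}. (c(l := b)) j - c j) = (\<Sum>j\<in>{n<..l}. (c'(l := b)) j - c' j)"
    by (rule sum.cong) (use l(2) in auto)
  moreover have "n \<le> l" using l(1) N by simp
  ultimately show "\<exists>M\<ge>n. \<exists>d d'. (f, d) \<in> chacon_level n \<and> (f', d') \<in> chacon_level n \<and> d \<noteq> c \<and>
      (\<forall>l. l \<le> N \<or> M < l \<longrightarrow> d l = c l \<and> d' l = c' l) \<and>
      (\<Sum>l\<in>{n<..M}. d l - c l) = (\<Sum>l\<in>{n<..M}. d' l - c' l)"
    by meson
qed

lemma recurrent_point_if_zero_digits: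
  assumes c: "(f, c) \<in> chacon_level n" and c': "(f', c') \<in> chacon_level n"
    and inf: "infinite {l. l > n \<and> c l \<noteq> 0 \<and> c' l = 0}"
  shows "recurrent_point (map_prod (chacon_T 1) (chacon_T 1)) (chacon_pt n (f, c), chacon_pt n (f', c'))"
proof (rule recurrent_point_if_change_digits[OF c c'])
  fix N assume N: "n \<le> N"
  let ?A = "{l. l > n \<and> c l \<noteq> 0 \<and> c' l = 0}"
  obtain m where m: "m > N" "m \<in> ?A"
    using inf unfolding infinite_nat_iff_unbounded by blast
  \<comment> \<open>The level \<open>m\<close> comes first, since its loss of h_{m-1} fixes the
    number of levels of \<open>S\<close>, each of which gains 1.\<close>
  have "infinite (?A - {..m})" using inf by simp
  from infinite_arbitrarily_large[OF this, of "nat (chacon_h (m - 1))"]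
  obtain S where S: "finite S" "card S = nat (chacon_h (m - 1))" "S \<subseteq> ?A - {..m}"
    by blast
  have h: "chacon_h j > 0" for j using chacon_h_ge[of j] by simp
  have "S \<noteq> {}" using S(2) h[of "m - 1"] by auto
  then have "Max S \<in> S" using S(1) by (rule Max_in[rotated])
  then have Max: "m < Max S" using S(3) by auto
  \<comment> \<open>The map c -> 1 - c swaps the two nonzero elements of C_l, so the new digits on
    \<open>S\<close> are admissible. At \<open>m\<close> the sign of \<open>c m\<close> decides
    which of the two sequences changes.\<close>
  define d where "d l = (if l \<in> S \<or> l = m \<and> c m < 0 then 0 else c l)" for l
  define d' where
    "d' l = (if l \<in> S then 1 - c l else if l = m \<and> c m > 0 then - chacon_h (m - 1) else c' l)" for l
  have dig: "c l = - chacon_h (l - 1) \<or> c l = chacon_h (l - 1) + 1" if "l \<in> ?A" for l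
    using chacon_level_digit[OF c, of l] that by auto
  have digS: "c l = - chacon_h (l - 1) \<or> c l = chacon_h (l - 1) + 1" "c' l = 0" "l > m" "c l \<noteq> 0"
    if "l \<in> S" for l
    using dig[of l] that S(3) by auto
  have mS: "m \<notin> S" and nm: "n < m" using S m N by auto
  have ld: "(f, d) \<in> chacon_level n"
  proof (rule chacon_level_change_digits[OF c])
    show "d l \<in> chacon_C l" if "l > n" for l
      using chacon_level_digit[OF c that] by (auto simp: d_def chacon_C_def)
    show "d l = c l" if "l \<le> n" for l using that nm digS(3)[of l] by (auto simp: d_def)
  qed
  have ld': "(f', d') \<in> chacon_level n"
  proof (rule chacon_level_change_digits[OF c'])
    show "d' l \<in> chacon_C l" if "l > n" for l
      using chacon_level_digit[OF c' that] digS(1)[of l] by (auto simp: d'_def chacon_C_def)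
    show "d' l = c' l" if "l \<le> n" for l using that nm digS(3)[of l] by (auto simp: d'_def)
  qed
  have change: "(d' l - c' l) - (d l - c l) =
      (if l \<in> S then 1 else 0) + (if l = m then - chacon_h (m - 1) else 0)" for l
    using dig[OF m(2)] m(2) h[of "m - 1"] digS(2)[of l] mS by (auto simp: d_def d'_def)
  have "S \<subseteq> {n<..Max S}" using S by auto
  then have "{n<..Max S} \<inter> S = S" by blast
  then have S_sum: "(\<Sum>l\<in>{n<..Max S}. if l \<in> S then 1 else 0) = int (card S)"
    by (simp flip: sum.inter_restrict)
  have "(\<Sum>l\<in>{n<..Max S}. d' l - c' l) - (\<Sum>l\<in>{n<..Max S}. d l - c l) = int (card S) - chacon_h (m - 1)"
    unfolding sum_subtractf[symmetric] change sum.distrib S_sum using nm Max by simp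
  then have sum: "(\<Sum>l\<in>{n<..Max S}. d l - c l) = (\<Sum>l\<in>{n<..Max S}. d' l - c' l)"
    using S(2) h[of "m - 1"] by simp
  \<comment> \<open>A level of \<open>S\<close> serves as witness because at \<open>m\<close>
    possibly only the second sequence changes.\<close>
  obtain s where "s \<in> S" using \<open>S \<noteq> {}\<close> by blast
  then have "d s \<noteq> c s" using digS(4) by (simp add: d_def)
  then have "d \<noteq> c" by auto
  moreover have "d l = c l \<and> d' l = c' l" if "l \<le> N \<or> Max S < l" for l
  proof -
    have "l \<notin> S" using that digS(3)[of l] m(1) S(1) by (auto dest: Max_ge)
    moreover have "l \<noteq> m" using that m(1) Max by auto
    ultimately show ?thesis by (simp add: d_def d'_def)
  qed
  moreover have "n \<le> Max S" using nm Max by simp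
  ultimately show "\<exists>M\<ge>n. \<exists>d d'. (f, d) \<in> chacon_level n \<and> (f', d') \<in> chacon_level n \<and> d \<noteq> c \<and>
      (\<forall>l. l \<le> N \<or> M < l \<longrightarrow> d l = c l \<and> d' l = c' l) \<and>
      (\<Sum>l\<in>{n<..M}. d l - c l) = (\<Sum>l\<in>{n<..M}. d' l - c' l)"
    using ld ld' sum by blast
qed

text \<open>With three possible digits, a pair that is not opposite is either equal or has exactly
  one zero. One of these three cases occurs infinitely often.\<close>

lemma recurrent_point_if_not_opposite:
  assumes c: "(f, c) \<in> chacon_level n" and c': "(f', c') \<in> chacon_level n"
    and not: "\<not> (\<exists>L>n. \<forall>l>L. {c l, c' l} = {- chacon_h (l - 1), chacon_h (l - 1) + 1})"
  shows "recurrent_point (map_prod (chacon_T 1) (chacon_T 1)) (chacon_pt n (f, c), chacon_pt n (f', c'))"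
proof -
  let ?E = "{l. c l = c' l}" and ?A = "{l. l > n \<and> c l \<noteq> 0 \<and> c' l = 0}"
    and ?B = "{l. l > n \<and> c' l \<noteq> 0 \<and> c l = 0}"
  have "\<exists>l>m. l \<in> ?E \<union> ?A \<union> ?B" for m
  proof -
    have "max m (Suc n) > n" by simp
    with not obtain l where l: "l > max m (Suc n)" "{c l, c' l} \<noteq> {- chacon_h (l - 1), chacon_h (l - 1) + 1}"
      by blast
    then have "l > n" by simp
    then have "l \<in> ?E \<union> ?A \<union> ?B"
      using l(2) chacon_level_digit[OF c, of l] chacon_level_digit[OF c', of l] by auto
    then show ?thesis using l(1) by auto
  qed
  then have "infinite (?E \<union> ?A \<union> ?B)" unfolding infinite_nat_iff_unbounded by blast
  then consider "infinite ?E" | "infinite ?A" | "infinite ?B" by blast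
  then show ?thesis
  proof cases
    case 3
    then show ?thesis
      using recurrent_point_if_zero_digits[OF c' c] unfolding recurrent_point_map_prod_iff by meson
  qed (use recurrent_point_if_equal_digits[OF c c'] recurrent_point_if_zero_digits[OF c c'] in blast)+
qed

section \<open>The levels as an increasing open cover of the limit\<close>

lemma chacon_pt_image_mono:
  assumes "m \<le> k"
  shows "chacon_pt m ` chacon_level m \<subseteq> chacon_pt k ` chacon_level k"
proof
  fix x assume "x \<in> chacon_pt m ` chacon_level m"
  then obtain p where "p \<in> chacon_level m" "x = chacon_pt m p" by blast
  then show "x \<in> chacon_pt k ` chacon_level k"
    using chacon_pt_push[of p m k] chacon_push_in[OF assms] assms by (metis imageI)
qed

text \<open>Whether a point of X_k comes from X_m depends only on its first coordinate: the digits
  of \<open>d\<close> up to \<open>k\<close> can be spliced with any tail.\<close>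

lemma chacon_push_append:
  assumes "m \<le> k" "(g, d) \<in> chacon_level m" "(f, c) \<in> chacon_level k"
    and "f = fst (chacon_push m k (g, d))"
  shows "(f, c) \<in> chacon_push m k ` chacon_level m"
proof -
  define e where "e l = (if l \<le> k then d l else c l)" for l
  have "(g, e) \<in> chacon_level m"
    by (rule chacon_level_change_digits[OF assms(2)])
      (use assms in \<open>auto simp: e_def chacon_level_iff PiE_iff\<close>)
  moreover have "restrict e {k<..} = c"
    using assms(3) by (auto simp: e_def fun_eq_iff chacon_level_iff PiE_iff extensional_def)
  moreover have "(\<Sum>l\<in>{m<..k}. e l) = (\<Sum>l\<in>{m<..k}. d l)" by (auto simp: e_def)
  ultimately have "chacon_push m k (g, e) = (f, c)"
    using assms chacon_push_eq[OF assms(1)] by simp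
  then show ?thesis using \<open>(g, e) \<in> chacon_level m\<close> by (metis imageI)
qed

text \<open>In X_k the preimage is everything if k \<le> m; otherwise it is cut out by a condition
  on the discrete coordinate in F_k.\<close>

lemma open_chacon_pt_image: "open (chacon_pt m ` chacon_level m)"
  unfolding open_chacon_def
proof
  fix k
  let ?S = "{p \<in> chacon_level k. chacon_pt k p \<in> chacon_pt m ` chacon_level m}"
  show "openin (chacon_level_top k) ?S"
  proof (cases "k \<le> m")
    case True
    then have "?S = topspace (chacon_level_top k)"
      using chacon_pt_image_mono[of k m] by auto
    then show ?thesis using openin_topspace by metis
  next
    case False
    then have mk: "m \<le> k" by simp
    have *: "chacon_pt k (f, c) \<in> chacon_pt m ` chacon_level m \<longleftrightarrow>
        f \<in> fst ` chacon_push m k ` chacon_level m" (is "?l \<longleftrightarrow> ?r")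
      if fc: "(f, c) \<in> chacon_level k" for f c
    proof
      assume ?l
      then obtain q where q: "q \<in> chacon_level m" "chacon_pt k (f, c) = chacon_pt m q" by blast
      then have "chacon_pt k (f, c) = chacon_pt k (chacon_push m k q)"
        using chacon_pt_push[OF q(1) mk] by simp
      then have "(f, c) = chacon_push m k q"
        using inj_onD[OF inj_on_chacon_pt _ fc chacon_push_in[OF mk q(1)]] by blast
      then show ?r using q(1) by (metis fst_conv imageI)
    next
      assume ?r
      then obtain g d where "(g, d) \<in> chacon_level m" "f = fst (chacon_push m k (g, d))" by auto
      then have "(f, c) \<in> chacon_push m k ` chacon_level m"
        using chacon_push_append[OF mk _ fc] by blast
      then show ?l using chacon_pt_push[OF _ mk] by (metis (no_types, lifting) imageE imageI)
    qed
    have "?S = {p \<in> topspace (chacon_level_top k).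
        fst p \<in> fst ` chacon_push m k ` chacon_level m \<inter> chacon_F k}"
      unfolding topspace_chacon_level_top
    proof (intro Collect_cong)
      fix p :: "int \<times> (nat \<Rightarrow> int)"
      obtain f c where "p = (f, c)" by force
      then show "p \<in> chacon_level k \<and> chacon_pt k p \<in> chacon_pt m ` chacon_level m \<longleftrightarrow>
          p \<in> chacon_level k \<and> fst p \<in> fst ` chacon_push m k ` chacon_level m \<inter> chacon_F k"
        using *[of f c] by (simp only: fst_conv Int_iff) (metis chacon_level_iff)
    qed
    moreover have "continuous_map (chacon_level_top k) (discrete_topology (chacon_F k)) fst"
      unfolding chacon_level_top_def by (rule continuous_map_fst)
    then have "openin (chacon_level_top k) {p \<in> topspace (chacon_level_top k).
        fst p \<in> fst ` chacon_push m k ` chacon_level m \<inter> chacon_F k}"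
      by (rule openin_continuous_map_preimage) (simp only: openin_discrete_topology Int_lower2)
    ultimately show ?thesis by (simp only:)
  qed
qed

text \<open>Finitely many of the increasing open levels cover \<open>K\<close>, so the largest one
  does. The parameter \<open>j\<close> allows \<open>m\<close> to be taken as large as
  desired.\<close>

lemma compact_chacon_subset_level:
  assumes "compact K"
  obtains m where "m \<ge> j" "K \<subseteq> chacon_pt m ` chacon_level m"
proof -
  let ?X = "\<lambda>m. chacon_pt m ` chacon_level m"
  have "K \<subseteq> (\<Union>m\<in>UNIV. ?X m)"
  proof
    fix x show "x \<in> (\<Union>m\<in>UNIV. ?X m)" by (rule chacon_pt_cases[of x]) blast
  qed
  then obtain M where M: "finite M" "K \<subseteq> (\<Union>m\<in>M. ?X m)"
    using compactE_image[OF assms, of UNIV ?X] open_chacon_pt_image by metis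
  show ?thesis
  proof (rule that[of "Max (insert j M)"])
    have "?X m \<subseteq> ?X (Max (insert j M))" if "m \<in> M" for m
      by (rule chacon_pt_image_mono) (use M(1) that in simp)
    then show "K \<subseteq> ?X (Max (insert j M))" using M(2) by blast
  qed (use M(1) in simp)
qed

section \<open>Rigidity of return times for opposite digits\<close>

lemma chacon_level_digit_bounds:
  assumes "(f, c) \<in> chacon_level n" "n \<le> j"
  shows "- chacon_h j \<le> c (Suc j)" "c (Suc j) \<le> chacon_h j + 1"
  using chacon_level_digit[OF assms(1), of "Suc j"] assms(2) chacon_h_ge[of j] by auto

text \<open>Two digits at level j + 1 differ by at most 2h + 1, where h = h_j. Doubled, the base
  case is at most 2(h - 1) + 2(2h + 1) = 6h, and the step stays below h + 2(2h + 1) \<le> 6h + 1. At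
  j = m the bound can fail, hence the start at \<open>Suc m\<close>.\<close>

lemma chacon_position_diff_bound:
  assumes "(f, c) \<in> chacon_level m" "(f', c') \<in> chacon_level m" "Suc m \<le> j"
  shows "2 * \<bar>(f' + (\<Sum>l\<in>{m<..j}. c' l)) - (f + (\<Sum>l\<in>{m<..j}. c l))\<bar> < chacon_h j"
  using assms(3)
proof (induction j rule: dec_induct)
  case base
  have sing: "{m<..Suc m} = {Suc m}" by auto
  have "- chacon_h m < 2 * f" "2 * f < chacon_h m" "- chacon_h m < 2 * f'" "2 * f' < chacon_h m"
    using assms(1,2) by (simp_all add: chacon_level_iff chacon_F_iff)
  then show ?case
    using chacon_level_digit_bounds[OF assms(1) order_refl] chacon_level_digit_bounds[OF assms(2) order_refl]
    by (simp add: sing)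
next
  case (step j)
  have ins: "{m<..Suc j} = insert (Suc j) {m<..j}" using step.hyps by auto
  have "m \<le> j" using step.hyps by simp
  note bounds = chacon_level_digit_bounds[OF assms(1) this] chacon_level_digit_bounds[OF assms(2) this]
  have h: "chacon_h j > 0" using chacon_h_ge[of j] by simp
  have "2 * \<bar>y\<bar> < 6 * h + 1"
    if "2 * \<bar>x\<bar> < h" "- h \<le> u" "u \<le> h + 1" "- h \<le> u'" "u' \<le> h + 1" "h > 0" "y = x + u' - u"
    for x y u u' h :: int
    using that by linarith
  from this[OF step.IH bounds h] show ?case by (simp add: ins)
qed

text \<open>Equal displacements at level \<open>Suc j\<close> force the digits there to be
  unchanged, so the displacements at level \<open>j\<close> are equal too. Descending to
  \<open>Suc m\<close> leaves only one digit to account for.\<close>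

lemma chacon_position_shift_eq:
  assumes "(f, c) \<in> chacon_level m" "(f', c') \<in> chacon_level m"
    and "(g, d) \<in> chacon_level m" "(g', d') \<in> chacon_level m"
    and opp: "\<And>l. l > m \<Longrightarrow> {c l, c' l} = {- chacon_h (l - 1), chacon_h (l - 1) + 1}"
    and "Suc m \<le> j"
    and "(g' + (\<Sum>l\<in>{m<..j}. d' l)) - (f' + (\<Sum>l\<in>{m<..j}. c' l)) =
         (g + (\<Sum>l\<in>{m<..j}. d l)) - (f + (\<Sum>l\<in>{m<..j}. c l))"
  shows "(g + (\<Sum>l\<in>{m<..j}. d l)) - (f + (\<Sum>l\<in>{m<..j}. c l)) = g + d (Suc m) - (f + c (Suc m))"
  using assms(6,7)
proof (induction j rule: dec_induct)
  case base
  have [simp]: "{m<..Suc m} = {Suc m}" by auto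
  show ?case by simp
next
  case (step j)
  let ?P = "\<lambda>a e. a + (\<Sum>l\<in>{m<..j}. e l)"
  have [simp]: "{m<..Suc j} = insert (Suc j) {m<..j}" using step.hyps by auto
  have m: "m < Suc j" using step.hyps by simp
  have eq: "(d' (Suc j) - d (Suc j)) - (c' (Suc j) - c (Suc j)) = (?P f' c' - ?P f c) - (?P g' d' - ?P g d)"
    using step.prems by simp
  have "\<bar>(d' (Suc j) - d (Suc j)) - (c' (Suc j) - c (Suc j))\<bar> < chacon_h j"
  proof -
    \<comment> \<open>Both position differences are below h_j / 2 in absolute value, so the digit
      difference changes by less than h_j.\<close>
    have "\<bar>a - b\<bar> < h" if "2 * \<bar>a\<bar> < h" "2 * \<bar>b\<bar> < h" for a b h :: int
      using that by linarith
    from this[OF chacon_position_diff_bound[OF assms(1,2) step.hyps(1)]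
        chacon_position_diff_bound[OF assms(3,4) step.hyps(1)]]
    show ?thesis unfolding eq .
  qed
  moreover have "c (Suc j) = - chacon_h j \<and> c' (Suc j) = chacon_h j + 1 \<or>
      c' (Suc j) = - chacon_h j \<and> c (Suc j) = chacon_h j + 1"
    using opp[OF m] by (simp add: doubleton_eq_iff) auto
  \<comment> \<open>The difference 2h + 1 or -(2h + 1) is attained by a single pair of digits, and
    the nearest other difference is h away.\<close>
  ultimately have "d (Suc j) = c (Suc j) \<and> d' (Suc j) = c' (Suc j)"
    using chacon_level_digit[OF assms(3) m] chacon_level_digit[OF assms(4) m] chacon_h_ge[of j]
    by auto
  then show ?case using step.IH step.prems by simp
qed

text \<open>In X_j with \<open>j\<close> large, \<open>chacon_T k\<close> just adds \<open>k\<close>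
  to the first coordinate, so the time can be read off from the positions in F_j.\<close>

lemma chacon_T_mem_level_position:
  assumes "(f, c) \<in> chacon_level m" "chacon_T k (chacon_pt m (f, c)) \<in> chacon_pt m ` chacon_level m"
  obtains g d M where "(g, d) \<in> chacon_level m" "m \<le> M"
    "\<And>j. M \<le> j \<Longrightarrow> (g + (\<Sum>l\<in>{m<..j}. d l)) - (f + (\<Sum>l\<in>{m<..j}. c l)) = k"
proof -
  obtain g d where gd: "(g, d) \<in> chacon_level m" "chacon_T k (chacon_pt m (f, c)) = chacon_pt m (g, d)"
    using assms(2) by auto
  \<comment> \<open>From this level on, \<open>chacon_push_margin\<close> leaves room for a shift by
    \<open>k\<close> inside F_j.\<close>
  define M where "M = Suc (m + nat \<bar>k\<bar>)"
  have "(g + (\<Sum>l\<in>{m<..j}. d l)) - (f + (\<Sum>l\<in>{m<..j}. c l)) = k" if "M \<le> j" for j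
  proof -
    have j: "m \<le> j" "m < j" "\<bar>k\<bar> < int j" using that by (auto simp: M_def)
    obtain a e where ae: "chacon_push m j (f, c) = (a, e)" by force
    then have lev: "(a, e) \<in> chacon_level j" "k + a \<in> chacon_F j"
      using chacon_push_in[OF j(1) assms(1)] chacon_push_margin[OF assms(1) j(2,3)] by auto
    have "chacon_pt j (chacon_push m j (g, d)) = chacon_pt j (k + a, e)"
      using chacon_pt_push[OF gd(1) j(1)] chacon_pt_push[OF assms(1) j(1)] gd(2)
        chacon_T_pt[OF lev] by (simp add: ae)
    moreover have "(k + a, e) \<in> chacon_level j" using lev by (simp add: chacon_level_iff)
    ultimately have "chacon_push m j (g, d) = (k + a, e)"
      using inj_onD[OF inj_on_chacon_pt _ chacon_push_in[OF j(1) gd(1)]] by blast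
    then show ?thesis
      using chacon_push_eq[OF j(1) gd(1)] chacon_push_eq[OF j(1) assms(1)] ae by simp
  qed
  then show ?thesis using that[of g d M] gd(1) by (simp add: M_def)
qed

text \<open>By rigidity \<open>k\<close> is determined by \<open>g\<close> and
  \<open>d (Suc m)\<close>, which range over finite sets.\<close>

lemma finite_return_times_if_opposite:
  assumes c: "(f, c) \<in> chacon_level m" and c': "(f', c') \<in> chacon_level m"
    and opp: "\<And>l. l > m \<Longrightarrow> {c l, c' l} = {- chacon_h (l - 1), chacon_h (l - 1) + 1}"
  shows "finite {k. chacon_T k (chacon_pt m (f, c)) \<in> chacon_pt m ` chacon_level m \<and>
                    chacon_T k (chacon_pt m (f', c')) \<in> chacon_pt m ` chacon_level m}"
    (is "finite ?R")
proof (rule finite_subset)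
  show "?R \<subseteq> (\<lambda>(a, b). a + b - (f + c (Suc m))) ` (chacon_F m \<times> chacon_C (Suc m))"
  proof
    fix k assume "k \<in> ?R"
    then have k: "chacon_T k (chacon_pt m (f, c)) \<in> chacon_pt m ` chacon_level m"
      "chacon_T k (chacon_pt m (f', c')) \<in> chacon_pt m ` chacon_level m" by auto
    obtain g d M where gd: "(g, d) \<in> chacon_level m" "m \<le> M"
      "\<And>j. M \<le> j \<Longrightarrow> (g + (\<Sum>l\<in>{m<..j}. d l)) - (f + (\<Sum>l\<in>{m<..j}. c l)) = k"
      using chacon_T_mem_level_position[OF c k(1)] by metis
    obtain g' d' M' where gd': "(g', d') \<in> chacon_level m" "m \<le> M'"
      "\<And>j. M' \<le> j \<Longrightarrow> (g' + (\<Sum>l\<in>{m<..j}. d' l)) - (f' + (\<Sum>l\<in>{m<..j}. c' l)) = k"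
      using chacon_T_mem_level_position[OF c' k(2)] by metis
    let ?j = "Suc (max M M')"
    have j: "M \<le> ?j" "M' \<le> ?j" "Suc m \<le> ?j" using gd(2) by auto
    have "g + d (Suc m) - (f + c (Suc m)) = k"
      using chacon_position_shift_eq[OF c c' gd(1) gd'(1) opp j(3)] gd(3)[OF j(1)] gd'(3)[OF j(2)]
      by (simp only:)
    moreover have "g \<in> chacon_F m" "d (Suc m) \<in> chacon_C (Suc m)"
      using gd(1) by (auto simp: chacon_level_iff)
    ultimately show "k \<in> (\<lambda>(a, b). a + b - (f + c (Suc m))) ` (chacon_F m \<times> chacon_C (Suc m))"
      by force
  qed
qed (simp add: chacon_F_def chacon_C_def)

text \<open>One level X_m with m \<ge> L contains both projections of \<open>K\<close>. Pushed to
  that level, the points have opposite digits at every remaining index.\<close>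

lemma finite_compact_visits_if_opposite:
  assumes c: "(f, c) \<in> chacon_level n" and c': "(f', c') \<in> chacon_level n"
    and "n \<le> L" and opp: "\<And>l. l > L \<Longrightarrow> {c l, c' l} = {- chacon_h (l - 1), chacon_h (l - 1) + 1}"
    and K: "compact (K :: (chacon \<times> chacon) set)"
  shows "finite {k. (chacon_T k (chacon_pt n (f, c)), chacon_T k (chacon_pt n (f', c'))) \<in> K}"
proof -
  have "compact (fst ` K \<union> snd ` K)"
    using K by (intro compact_Un compact_continuous_image continuous_intros)
  then obtain m where m: "m \<ge> L" "fst ` K \<union> snd ` K \<subseteq> chacon_pt m ` chacon_level m"
    using compact_chacon_subset_level by metis
  have nm: "n \<le> m" using m(1) assms(3) by simp
  obtain a e where ae: "chacon_push n m (f, c) = (a, e)" by force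
  obtain a' e' where ae': "chacon_push n m (f', c') = (a', e')" by force
  have lev: "(a, e) \<in> chacon_level m" "(a', e') \<in> chacon_level m"
    using chacon_push_in[OF nm] c c' ae ae' by metis+
  have "e = restrict c {m<..}" "e' = restrict c' {m<..}"
    using chacon_push_eq[OF nm c] chacon_push_eq[OF nm c'] ae ae' by auto
  then have "{e l, e' l} = {- chacon_h (l - 1), chacon_h (l - 1) + 1}" if "l > m" for l
    using opp[of l] that m(1) by simp
  from finite_return_times_if_opposite[OF lev this]
  have "finite {k. chacon_T k (chacon_pt m (a, e)) \<in> chacon_pt m ` chacon_level m \<and>
                   chacon_T k (chacon_pt m (a', e')) \<in> chacon_pt m ` chacon_level m}" .
  moreover have "chacon_pt m (a, e) = chacon_pt n (f, c)" "chacon_pt m (a', e') = chacon_pt n (f', c')"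
    using chacon_pt_push[OF c nm] chacon_pt_push[OF c' nm] ae ae' by auto
  ultimately show ?thesis
    by (elim finite_subset[rotated]) (use m(2) in force)
qed

theorem proposition4p3:
  fixes n :: nat and x x' :: chacon and f f' :: int and c c' :: "nat \<Rightarrow> int"
  assumes "n > 0"
    and "(f, c) \<in> chacon_level n" and "x = chacon_pt n (f, c)"
    and "(f', c') \<in> chacon_level n" and "x' = chacon_pt n (f', c')"
  shows "((\<exists>L>n. \<forall>l>L. {c l, c' l} = {- chacon_h (l - 1), chacon_h (l - 1) + 1}) \<longrightarrow>
            (\<forall>K :: (chacon \<times> chacon) set. compact K \<longrightarrow>
               finite {k::int. int_iter (map_prod (chacon_T 1) (chacon_T 1)) k (x, x') \<in> K})) \<and>
         (\<not> (\<exists>L>n. \<forall>l>L. {c l, c' l} = {- chacon_h (l - 1), chacon_h (l - 1) + 1}) \<longrightarrow>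
            recurrent_point (map_prod (chacon_T 1) (chacon_T 1)) (x, x'))"
proof (intro conjI impI allI)
  fix K :: "(chacon \<times> chacon) set"
  assume "\<exists>L>n. \<forall>l>L. {c l, c' l} = {- chacon_h (l - 1), chacon_h (l - 1) + 1}" and K: "compact K"
  then obtain L where "n \<le> L" "\<And>l. l > L \<Longrightarrow> {c l, c' l} = {- chacon_h (l - 1), chacon_h (l - 1) + 1}"
    using less_imp_le by blast
  then show "finite {k::int. int_iter (map_prod (chacon_T 1) (chacon_T 1)) k (x, x') \<in> K}"
    using finite_compact_visits_if_opposite[OF assms(2,4) _ _ K]
    unfolding int_iter_map_prod_chacon_T assms(3,5) by blast
next
  assume "\<not> (\<exists>L>n. \<forall>l>L. {c l, c' l} = {- chacon_h (l - 1), chacon_h (l - 1) + 1})"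
  then show "recurrent_point (map_prod (chacon_T 1) (chacon_T 1)) (x, x')"
    using recurrent_point_if_not_opposite[OF assms(2,4)] assms(3,5) by simp
qed

end
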